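(* Let $\mathbb{P}$ be the law of a Galton–Watson tree with a fixed progeny distribution $\{p_n\}_{n\in\mathbb{N}}$ with $p_0=0$ and mean $\mu>1$, and let $p_c=1/\mu$. Then for $\mathbb{P}$-almost every tree $T$, the percolation density $\theta_T(p)$ is analytic in the interval $(p_c,1]$.
   Context: The tree $T$ sampled from $\mathbb{P}$ is rooted at $o$. Given a locally finite rooted tree $T$ with root $o$, $\Pr_{p,T}$ denotes the law of Bernoulli bond percolation on $T$ with parameter $p$ (each edge is independently occupied with probability $p$ and vacant otherwise), $C_o$ denotes the connected component of $o$ in the subgraph of occupied edges, and $\theta_T(p):=\Pr_{p,T}(|C_o|=\infty)$. It is well known that $\mathbb{P}$-almost surely the percolation threshold of $T$ equals $1/\mu$. A function $f$ is analytic on an interval $I\subset\mathbb{R}$ if every $x\in I$ is the centre of an open disc $D\subset\mathbb{C}$ on which there is a holomorphic function agreeing with $f$ on $D\cap I$. *)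

theory Defs
  imports "HOL-Probability.Probability" "HOL-Complex_Analysis.Complex_Analysis"
begin

section \<open>Analyticity on a real interval\<close>

definition analytic_on_interval :: "(real \<Rightarrow> real) \<Rightarrow> real set \<Rightarrow> bool" where
  "analytic_on_interval f I \<longleftrightarrow>
     (\<forall>x\<in>I. \<exists>r>0. \<exists>g. g holomorphic_on ball (complex_of_real x) r \<and>
        (\<forall>y\<in>I. complex_of_real y \<in> ball (complex_of_real x) r \<longrightarrow>
           g (complex_of_real y) = complex_of_real (f y)))"

section \<open>Bernoulli bond percolation\<close>

text \<open>A graph is given by its set \<open>E\<close> of edges, each edge being the unordered pair of its
  endpoints. A configuration maps the occupied edges to \<open>True\<close>.\<close>

definition bond_percolation :: "real \<Rightarrow> 'v set set \<Rightarrow> ('v set \<Rightarrow> bool) measure" where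
  "bond_percolation q E = PiM E (\<lambda>_. measure_pmf (bernoulli_pmf q))"

definition cluster :: "'v set set \<Rightarrow> ('v set \<Rightarrow> bool) \<Rightarrow> 'v \<Rightarrow> 'v set" where
  "cluster E \<omega> r = {v. (r, v) \<in> {(u, w). {u, w} \<in> E \<and> \<omega> {u, w}}\<^sup>*}"

section \<open>Rooted trees in Ulam--Harris coding\<close>

text \<open>A vertex is a finite sequence of natural numbers: the root is the empty list and the
  children of \<open>v\<close> are of the form \<open>v @ [i]\<close>. A tree is the set of its vertices.\<close>

definition tree_edges :: "nat list set \<Rightarrow> nat list set set" where
  "tree_edges T = {{v, v @ [i]} | v i. v \<in> T \<and> v @ [i] \<in> T}"

definition percolation_density :: "nat list set \<Rightarrow> real \<Rightarrow> real" where
  "percolation_density T q =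
     measure (bond_percolation q (tree_edges T))
       {\<omega> \<in> space (bond_percolation q (tree_edges T)). infinite (cluster (tree_edges T) \<omega> [])}"

section \<open>Galton--Watson trees\<close>

text \<open>Given a number \<open>\<xi> v\<close> of children for every potential vertex \<open>v\<close>, the children of \<open>v\<close>
  in the tree are \<open>v @ [i]\<close> for \<open>i < \<xi> v\<close>.\<close>

definition tree_of :: "(nat list \<Rightarrow> nat) \<Rightarrow> nat list set" where
  "tree_of \<xi> = {v. \<forall>k<length v. v ! k < \<xi> (take k v)}"

text \<open>The \<open>\<sigma>\<close>-algebra on trees generated by the events that a given vertex is present; on
  locally finite trees it is the Borel \<open>\<sigma>\<close>-algebra of local convergence.\<close>

definition tree_space :: "nat list set measure" where
  "tree_space = sigma UNIV (range (\<lambda>v. {T. v \<in> T}))"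

definition galton_watson :: "nat pmf \<Rightarrow> nat list set measure" where
  "galton_watson p = distr (PiM UNIV (\<lambda>_. measure_pmf p)) tree_space tree_of"

text \<open>Well-definedness: \<open>distr\<close> and \<open>measure\<close> have junk values on non-measurable arguments.\<close>

lemma measurable_tree_of [measurable]:
  "tree_of \<in> measurable (PiM UNIV (\<lambda>_. measure_pmf p)) tree_space"
  unfolding tree_space_def
proof (rule measurable_sigma_sets[OF sets_measure_of])
  show "tree_of \<in> space (PiM UNIV (\<lambda>_. measure_pmf p)) \<rightarrow> UNIV" by simp
next
  fix A :: "nat list set set" assume "A \<in> range (\<lambda>v. {T. v \<in> T})"
  then obtain v where A: "A = {T. v \<in> T}" by auto
  have c [measurable]: "(\<lambda>\<xi>. \<xi> u) \<in> measurable (PiM UNIV (\<lambda>_. measure_pmf p)) (count_space UNIV)" for u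
    using measurable_component_singleton[of u UNIV "\<lambda>_. measure_pmf p"] by simp
  have "{\<xi> \<in> space (PiM UNIV (\<lambda>_. measure_pmf p)). \<forall>k\<in>{..<length v}. v ! k < \<xi> (take k v)}
      \<in> sets (PiM UNIV (\<lambda>_. measure_pmf p))"
    by measurable
  then show "tree_of -` A \<inter> space (PiM UNIV (\<lambda>_. measure_pmf p)) \<in> sets (PiM UNIV (\<lambda>_. measure_pmf p))"
    by (simp add: A tree_of_def vimage_def Int_def conj_commute Ball_def)
qed simp_all

lemma prob_space_galton_watson: "prob_space (galton_watson p)"
proof -
  interpret prob_space "PiM UNIV (\<lambda>_::nat list. measure_pmf p)"
    by (intro prob_space_PiM prob_space_measure_pmf)
  show ?thesis unfolding galton_watson_def by (rule prob_space_distr) measurable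
qed

lemma sets_infinite_cluster:
  fixes E :: "'v::countable set set"
  shows "{\<omega> \<in> space (bond_percolation q E). infinite (cluster E \<omega> r)} \<in> sets (bond_percolation q E)"
proof -
  let ?M = "bond_percolation q E"
  have c [measurable]: "Measurable.pred ?M (\<lambda>\<omega>. e \<in> E \<and> \<omega> e)" for e
  proof (cases "e \<in> E")
    case True
    then have "(\<lambda>\<omega>. \<omega> e) \<in> measurable ?M (count_space UNIV)"
      using measurable_component_singleton[of e E "\<lambda>_. measure_pmf (bernoulli_pmf q)"]
      by (simp add: bond_percolation_def)
    with True show ?thesis by simp
  qed simp
  have [measurable]: "Measurable.pred ?M (\<lambda>\<omega>. (u, v) \<in> {(u, w). {u, w} \<in> E \<and> \<omega> {u, w}} ^^ n)" for u v n
    by (induction n arbitrary: v) (simp_all add: relcomp_unfold)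
  have [measurable]: "Measurable.pred ?M (\<lambda>\<omega>. v \<in> cluster E \<omega> r)" for v
    by (simp add: cluster_def rtrancl_is_UN_relpow)
  have "infinite A \<longleftrightarrow> (\<forall>n. \<exists>v. v \<in> A \<and> n \<le> to_nat v)" for A :: "'v set"
  proof -
    have "infinite A \<longleftrightarrow> infinite (to_nat ` A)" by (simp add: finite_image_iff)
    also have "\<dots> \<longleftrightarrow> (\<forall>n. \<exists>v. v \<in> A \<and> n \<le> to_nat v)"
      unfolding infinite_nat_iff_unbounded_le by blast
    finally show ?thesis .
  qed
  then show ?thesis by simp
qed

end

theory Submission
  imports Defs "HOL-Library.Sublist"
begin

text \<open>The probability \<open>f\<^sub>n(q)\<close> that the cluster of the root does not reach level \<open>n\<close> is a polynomial
  in \<open>1 - q\<close> and \<open>q\<close> obtained by iterating \<open>f \<mapsto> \<Prod> (1 - q + q f)\<close> over the children, and it tends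
  to \<open>1 - \<theta>\<^sub>T(q)\<close>. Replacing \<open>1 - q\<close> and \<open>q\<close> by real numbers \<open>a \<ge> \<bar>1 - z\<bar>\<close> and \<open>b \<ge> \<bar>z\<bar>\<close> gives an
  increasing sequence \<open>F\<^sub>n\<close> whose increments dominate those of \<open>f\<^sub>n(z)\<close>. Averaged over the tree,
  \<open>E F\<^sub>n\<^sub>+\<^sub>1 = G (a + b E F\<^sub>n)\<close> for the generating function \<open>G\<close> of the progeny. For \<open>x > p\<^sub>c\<close> and
  \<open>(a, b)\<close> slightly above \<open>(1 - x, x)\<close> there is some \<open>s\<close> with \<open>G (a + b s) \<le> s\<close>, so \<open>E F\<^sub>n \<le> s\<close> for all
  \<open>n\<close> and \<open>F\<^sub>n\<close> is almost surely bounded. Hence \<open>f\<^sub>n\<close> converges uniformly on a complex disc around \<open>x\<close>.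
  Countably many pairs \<open>(a, b)\<close> suffice.\<close>

section \<open>Independence in product measures\<close>

text \<open>Restricting to \<open>I\<close> changes nothing on the product space, so the joint law
  of the coordinates is the product measure itself, that is, the product of its marginals.\<close>

lemma indep_vars_PiM_coordinate:
  assumes M: "\<And>i. prob_space (M i)" and I: "I \<noteq> {}"
  shows "prob_space.indep_vars (PiM I M) M (\<lambda>i \<omega>. \<omega> i) I"
proof -
  interpret P: product_prob_space M I by (intro product_prob_spaceI M)
  have r: "P.random_variable (M i) (\<lambda>\<omega>. \<omega> i)" if "i \<in> I" for i
    using that by (rule measurable_component_singleton)
  have "distr (PiM I M) (PiM I M) (\<lambda>\<omega>. \<lambda>i\<in>I. \<omega> i) = distr (PiM I M) (PiM I M) (\<lambda>\<omega>. \<omega>)"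
    by (intro distr_cong) (auto simp: space_PiM)
  also have "\<dots> = PiM I (\<lambda>i. distr (PiM I M) (M i) (\<lambda>\<omega>. \<omega> i))"
    by (simp add: distr_id P.PiM_component cong: PiM_cong)
  finally show ?thesis
    by (subst P.indep_vars_iff_distr_eq_PiM'[OF I r])
qed

lemma nn_integral_PiM_coordinate:
  assumes "\<And>i. prob_space (M i)" "i \<in> I" "f \<in> borel_measurable (M i)"
  shows "(\<integral>\<^sup>+\<omega>. f (\<omega> i) \<partial>PiM I M) = (\<integral>\<^sup>+x. f x \<partial>M i)"
proof -
  have "(\<integral>\<^sup>+\<omega>. f (\<omega> i) \<partial>PiM I M) = (\<integral>\<^sup>+x. f x \<partial>distr (PiM I M) (M i) (\<lambda>\<omega>. \<omega> i))"
    using assms by (subst nn_integral_distr) auto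
  then show ?thesis using assms by (simp add: distr_PiM_component)
qed

text \<open>Functions of disjoint blocks of coordinates are independent; \<open>local\<close>
  expresses that \<open>f j\<close> looks only at the block \<open>K j\<close>. It serves both for
  edges in percolation and for offspring counts in the random tree.\<close>

lemma nn_integral_prod_PiM_disjoint:
  fixes f :: "'j \<Rightarrow> ('i \<Rightarrow> 'a) \<Rightarrow> ennreal"
  assumes M: "\<And>i. prob_space (M i)" and I: "I \<noteq> {}" and J: "finite J"
    and K: "disjoint_family_on K J" "\<And>j. j \<in> J \<Longrightarrow> K j \<subseteq> I"
    and f: "\<And>j. j \<in> J \<Longrightarrow> f j \<in> borel_measurable (PiM (K j) M)"
    and local: "\<And>j \<omega>. j \<in> J \<Longrightarrow> f j (restrict \<omega> (K j)) = f j \<omega>"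
  shows "(\<integral>\<^sup>+\<omega>. (\<Prod>j\<in>J. f j \<omega>) \<partial>PiM I M) = (\<Prod>j\<in>J. \<integral>\<^sup>+\<omega>. f j \<omega> \<partial>PiM I M)"
proof -
  interpret prob_space "PiM I M" by (intro prob_space_PiM M)
  have "indep_vars (\<lambda>_. borel) (\<lambda>j \<omega>. f j (restrict \<omega> (K j))) J"
    by (rule indep_vars_compose2[OF indep_vars_restrict[OF indep_vars_PiM_coordinate[OF M I]]])
      (use K f in auto)
  from indep_vars_nn_integral[OF J this] show ?thesis
    by (simp add: local cong: prod.cong)
qed

section \<open>The extinction polynomials\<close>

text \<open>For \<open>a = 1 - q\<close> and \<open>b = q\<close> this is the probability that no occupied path of length \<open>n\<close>
  descends from \<open>v\<close>; \<open>a\<close> and \<open>b\<close> are kept independent so that the complex polynomials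
  \<open>extinction (1 - z) z\<close> can be dominated by real values with \<open>a + b > 1\<close>.\<close>

fun extinction :: "'a::comm_ring_1 \<Rightarrow> 'a \<Rightarrow> (nat list \<Rightarrow> nat) \<Rightarrow> nat \<Rightarrow> nat list \<Rightarrow> 'a" where
  "extinction a b \<xi> 0 v = 0"
| "extinction a b \<xi> (Suc n) v = (\<Prod>i<\<xi> v. a + b * extinction a b \<xi> n (v @ [i]))"

text \<open>Only the counts at descendants of \<open>v\<close> enter, which later makes the factors
  of different children independent.\<close>

lemma extinction_cong:
  assumes "\<And>w. \<xi> (v @ w) = \<xi>' (v @ w)"
  shows "extinction a b \<xi> n v = extinction a b \<xi>' n v"
  using assms
proof (induction n arbitrary: v)
  case (Suc n)
  have "\<xi> v = \<xi>' v" using Suc.prems[of "[]"] by simp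
  moreover have "extinction a b \<xi> n (v @ [i]) = extinction a b \<xi>' n (v @ [i])" for i
    by (rule Suc.IH) (use Suc.prems in simp)
  ultimately show ?case by simp
qed simp

lemma extinction_of_real:
  "extinction (of_real a) (of_real b) \<xi> n v =
    (of_real (extinction a b \<xi> n v) :: 'a::{real_algebra_1,comm_ring_1})"
  by (induction n arbitrary: v) simp_all

lemma extinction_nonneg:
  fixes a b :: real
  assumes "0 \<le> a" "0 \<le> b"
  shows "0 \<le> extinction a b \<xi> n v"
  using assms by (induction n arbitrary: v) (auto intro!: prod_nonneg add_nonneg_nonneg mult_nonneg_nonneg)

section \<open>Holomorphy and domination by real majorants\<close>

lemma holomorphic_extinction:
  "(\<lambda>z. extinction (1 - z) z \<xi> n v) holomorphic_on S"
  by (induction n arbitrary: v) (auto intro!: holomorphic_intros)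

text \<open>Telescoping: changing one factor at a time splits the difference of the products into
  terms with one increment each. The triangle inequality makes \<open>U'\<close> a majorant of
  \<open>u'\<close> as well.\<close>

lemma norm_prod_diff_le:
  fixes u u' :: "'i \<Rightarrow> 'a::{real_normed_field}" and U U' :: "'i \<Rightarrow> real"
  assumes "finite I"
    and "\<And>i. i \<in> I \<Longrightarrow> norm (u i) \<le> U i"
    and "\<And>i. i \<in> I \<Longrightarrow> norm (u' i - u i) \<le> U' i - U i"
  shows "norm (prod u' I - prod u I) \<le> prod U' I - prod U I"
  using assms
proof (induction I rule: finite_induct)
  case (insert j I)
  have u': "norm (u' i) \<le> U' i" if "i \<in> insert j I" for i
    using insert.prems[OF that] norm_triangle_sub[of "u' i" "u i"] by simp
  have U: "0 \<le> U j" "0 \<le> U' j - U j"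
    using order_trans[OF norm_ge_zero insert.prems(1)] order_trans[OF norm_ge_zero insert.prems(2)]
    by auto
  have "norm (prod u' (insert j I) - prod u (insert j I))
      = norm ((u' j - u j) * prod u' I + u j * (prod u' I - prod u I))"
    using insert.hyps by (simp add: algebra_simps)
  also have "\<dots> \<le> norm (u' j - u j) * norm (prod u' I) + norm (u j) * norm (prod u' I - prod u I)"
    by (metis norm_mult norm_triangle_ineq)
  also have "\<dots> \<le> (U' j - U j) * prod U' I + U j * (prod U' I - prod U I)"
    using insert u' U
    by (intro add_mono mult_mono) (auto simp: prod_norm[symmetric] intro!: prod_mono prod_nonneg)
  also have "\<dots> = prod U' (insert j I) - prod U (insert j I)"
    using insert.hyps by (simp add: algebra_simps)
  finally show ?case .
qed simp

text \<open>Sums and products preserve majorants, first of values and then of increments. The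
  induction on \<open>n\<close> starts from the value bound because level \<open>0\<close> has value
  zero.\<close>

lemma norm_extinction_diff_le:
  fixes \<alpha> \<beta> :: "'a::{real_normed_field}"
  assumes "norm \<alpha> \<le> a" "norm \<beta> \<le> b" "n \<le> m"
  shows "norm (extinction \<alpha> \<beta> \<xi> m v - extinction \<alpha> \<beta> \<xi> n v) \<le>
    extinction a b \<xi> m v - extinction a b \<xi> n v"
proof -
  have step: "norm (\<alpha> + \<beta> * x) \<le> a + b * X" if "norm x \<le> X" for x X
  proof -
    have "norm (\<alpha> + \<beta> * x) \<le> norm \<alpha> + norm \<beta> * norm x"
      by (metis norm_mult norm_triangle_ineq)
    also have "\<dots> \<le> a + b * X"
      using assms that order_trans[OF norm_ge_zero assms(2)] by (intro add_mono mult_mono) auto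
    finally show ?thesis .
  qed
  have bound: "norm (extinction \<alpha> \<beta> \<xi> n v) \<le> extinction a b \<xi> n v" for n v
  proof (induction n arbitrary: v)
    case (Suc n)
    then show ?case
      by (auto simp: prod_norm[symmetric] intro!: prod_mono step)
  qed simp
  show ?thesis
    using \<open>n \<le> m\<close>
  proof (induction n arbitrary: m v)
    case 0
    then show ?case using bound by simp
  next
    case (Suc n)
    then obtain k where m: "m = Suc k" "n \<le> k" by (cases m) auto
    show ?case
      unfolding m extinction.simps
    proof (intro norm_prod_diff_le step bound finite_lessThan)
      fix i
      have "norm (\<alpha> + \<beta> * extinction \<alpha> \<beta> \<xi> k (v @ [i]) - (\<alpha> + \<beta> * extinction \<alpha> \<beta> \<xi> n (v @ [i])))
          = norm \<beta> * norm (extinction \<alpha> \<beta> \<xi> k (v @ [i]) - extinction \<alpha> \<beta> \<xi> n (v @ [i]))"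
        by (simp add: norm_mult[symmetric] algebra_simps)
      also have "\<dots> \<le> b * (extinction a b \<xi> k (v @ [i]) - extinction a b \<xi> n (v @ [i]))"
        using assms(2) Suc.IH[OF m(2)] order_trans[OF norm_ge_zero assms(2)]
        by (intro mult_mono) auto
      finally show "norm (\<alpha> + \<beta> * extinction \<alpha> \<beta> \<xi> k (v @ [i]) - (\<alpha> + \<beta> * extinction \<alpha> \<beta> \<xi> n (v @ [i])))
          \<le> a + b * extinction a b \<xi> k (v @ [i]) - (a + b * extinction a b \<xi> n (v @ [i]))"
        by (simp add: algebra_simps)
    qed
  qed
qed

lemma incseq_extinction:
  fixes a b :: real
  assumes "0 \<le> a" "0 \<le> b"
  shows "incseq (\<lambda>n. extinction a b \<xi> n v)"
  using norm_extinction_diff_le[of a a b b] assms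
  by (intro monoI) (smt (verit) norm_ge_zero real_norm_def)

text \<open>The bounded increasing majorants form a Cauchy sequence, and since \<open>a\<close> and
  \<open>b\<close> do not depend on \<open>z\<close>, it controls the polynomials uniformly on
  \<open>S\<close>. A locally uniform limit of holomorphic functions is holomorphic.\<close>

lemma holomorphic_limit_extinction:
  assumes "0 \<le> a" "0 \<le> b"
    and S: "open S" "\<And>z. z \<in> S \<Longrightarrow> norm (1 - z) \<le> a" "\<And>z. z \<in> S \<Longrightarrow> norm z \<le> b"
    and bdd: "bdd_above (range (\<lambda>n. extinction a b \<xi> n v))"
  obtains g where "g holomorphic_on S"
    "\<And>z. z \<in> S \<Longrightarrow> (\<lambda>n. extinction (1 - z) z \<xi> n v) \<longlonglongrightarrow> g z"
proof -
  let ?F = "\<lambda>n. extinction a b \<xi> n v"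
  let ?f = "\<lambda>n z. extinction (1 - z) z \<xi> n v"
  have "Cauchy ?F"
    using incseq_extinction[OF assms(1,2)] bdd
    by (intro LIMSEQ_imp_Cauchy) (rule LIMSEQ_incseq_SUP)
  have "uniformly_Cauchy_on S ?f"
  proof (rule uniformly_Cauchy_onI')
    fix e :: real assume "e > 0"
    then obtain N where N: "\<And>m n. m \<ge> N \<Longrightarrow> n \<ge> N \<Longrightarrow> dist (?F m) (?F n) < e"
      using \<open>Cauchy ?F\<close> unfolding Cauchy_def by blast
    have "dist (?f m z) (?f n z) < e" if "z \<in> S" "N \<le> m" "m < n" for z m n
    proof -
      have "dist (?f m z) (?f n z) \<le> ?F n - ?F m"
        using norm_extinction_diff_le[OF S(2,3)[OF that(1)], of m n] that
        by (simp add: dist_norm norm_minus_commute)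
      also have "\<dots> < e" using N[of n m] that by (simp add: dist_real_def)
      finally show ?thesis .
    qed
    then show "\<exists>M. \<forall>z\<in>S. \<forall>m\<ge>M. \<forall>n>m. dist (?f m z) (?f n z) < e" by blast
  qed
  then have lim: "uniform_limit S ?f (\<lambda>z. lim (\<lambda>n. ?f n z)) sequentially"
    by (simp add: Cauchy_uniformly_convergent flip: uniformly_convergent_uniform_limit_iff)
  show thesis
  proof (rule that)
    show "(\<lambda>z. lim (\<lambda>n. ?f n z)) holomorphic_on S"
    proof (rule holomorphic_uniform_sequence[OF S(1) holomorphic_extinction])
      fix z assume "z \<in> S"
      then obtain d where "d > 0" "cball z d \<subseteq> S" using S(1) open_contains_cball by blast
      then show "\<exists>d>0. cball z d \<subseteq> S \<and>
          uniform_limit (cball z d) ?f (\<lambda>z. lim (\<lambda>n. ?f n z)) sequentially"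
        using uniform_limit_on_subset[OF lim] by blast
    qed
    show "(\<lambda>n. ?f n z) \<longlonglongrightarrow> lim (\<lambda>n. ?f n z)" if "z \<in> S" for z
      using tendsto_uniform_limitI[OF lim that] .
  qed
qed

section \<open>Percolation on a fixed tree\<close>

lemma Nil_in_tree_of: "[] \<in> tree_of \<xi>"
  by (simp add: tree_of_def)

lemma snoc_in_tree_of_iff: "v @ [i] \<in> tree_of \<xi> \<longleftrightarrow> v \<in> tree_of \<xi> \<and> i < \<xi> v"
  by (auto simp: tree_of_def less_Suc_eq nth_append)

lemma append_in_tree_ofD: "v @ w \<in> tree_of \<xi> \<Longrightarrow> v \<in> tree_of \<xi>"
  by (induction w rule: rev_induct) (simp_all add: snoc_in_tree_of_iff flip: append_assoc)

lemma tree_edges_tree_of_iff: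
  "e \<in> tree_edges (tree_of \<xi>) \<longleftrightarrow> (\<exists>v i. e = {v, v @ [i]} \<and> v \<in> tree_of \<xi> \<and> i < \<xi> v)"
  by (auto simp: tree_edges_def snoc_in_tree_of_iff)

lemma finite_level_tree_of: "finite {v \<in> tree_of \<xi>. length v = n}"
proof (induction n)
  case (Suc n)
  have "{v \<in> tree_of \<xi>. length v = Suc n} \<subseteq>
      (\<Union>v\<in>{v \<in> tree_of \<xi>. length v = n}. (\<lambda>i. v @ [i]) ` {..<\<xi> v})"
    by (auto simp: length_Suc_conv_rev snoc_in_tree_of_iff)
  then show ?case by (rule finite_subset) (use Suc.IH in auto)
qed (simp add: conj_commute cong: conj_cong)

section \<open>Occupied paths descending a given number of levels\<close>

fun reaches :: "(nat list \<Rightarrow> nat) \<Rightarrow> nat \<Rightarrow> nat list \<Rightarrow> (nat list set \<Rightarrow> bool) \<Rightarrow> bool" where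
  "reaches \<xi> 0 v \<omega> \<longleftrightarrow> True"
| "reaches \<xi> (Suc n) v \<omega> \<longleftrightarrow> (\<exists>i<\<xi> v. \<omega> {v, v @ [i]} \<and> reaches \<xi> n (v @ [i]) \<omega>)"

lemma reaches_Suc_imp: "reaches \<xi> (Suc n) v \<omega> \<Longrightarrow> reaches \<xi> n v \<omega>"
proof (induction n arbitrary: v)
  case (Suc n)
  from Suc.prems obtain i where "i < \<xi> v" "\<omega> {v, v @ [i]}" "reaches \<xi> (Suc n) (v @ [i]) \<omega>"
    unfolding reaches.simps(2)[of \<xi> "Suc n"] by blast
  moreover from this have "reaches \<xi> n (v @ [i]) \<omega>" by (intro Suc.IH)
  ultimately show ?case by auto
qed simp

lemma reaches_iff_path:
  assumes "v \<in> tree_of \<xi>"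
  shows "reaches \<xi> n v \<omega> \<longleftrightarrow>
    (\<exists>w. length w = n \<and> v @ w \<in> tree_of \<xi> \<and> (\<forall>k<n. \<omega> {v @ take k w, v @ take (Suc k) w}))"
  using assms
proof (induction n arbitrary: v)
  case (Suc n)
  have child: "reaches \<xi> n (v @ [i]) \<omega> \<longleftrightarrow> (\<exists>w. length w = n \<and> v @ i # w \<in> tree_of \<xi> \<and>
      (\<forall>k<n. \<omega> {v @ i # take k w, v @ i # take (Suc k) w}))" if "i < \<xi> v" for i
    using Suc.IH[of "v @ [i]"] Suc.prems that by (simp add: snoc_in_tree_of_iff)
  have bound: "i < \<xi> v" if "v @ i # w \<in> tree_of \<xi>" for i w
    using append_in_tree_ofD[of "v @ [i]" w \<xi>] that by (simp add: snoc_in_tree_of_iff)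
  have "reaches \<xi> (Suc n) v \<omega> \<longleftrightarrow> (\<exists>i w. length w = n \<and> v @ i # w \<in> tree_of \<xi> \<and> \<omega> {v, v @ [i]} \<and>
      (\<forall>k<n. \<omega> {v @ i # take k w, v @ i # take (Suc k) w}))"
    unfolding reaches.simps using child bound by blast
  also have "\<dots> \<longleftrightarrow> (\<exists>w. length w = Suc n \<and> v @ w \<in> tree_of \<xi> \<and>
      (\<forall>k<Suc n. \<omega> {v @ take k w, v @ take (Suc k) w}))" (is "?L \<longleftrightarrow> (\<exists>w. ?R w)")
  proof
    assume ?L
    then obtain i w where "?R (i # w)" by (auto simp: All_less_Suc2)
    then show "\<exists>w. ?R w" ..
  next
    assume "\<exists>w. ?R w"
    then obtain w where w: "?R w" ..
    then obtain i u where "w = i # u" by (cases w) auto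
    with w show ?L by (intro exI[of _ i] exI[of _ u]) (simp add: All_less_Suc2)
  qed
  finally show ?case .
qed simp

text \<open>A walk in the cluster may backtrack, but the path from the root to its current vertex
  stays occupied: a step to a child appends the edge just crossed, and a step to the parent drops
  the last edge.\<close>

lemma cluster_tree_of:
  "cluster (tree_edges (tree_of \<xi>)) \<omega> [] =
    {v \<in> tree_of \<xi>. \<forall>k<length v. \<omega> {take k v, take (Suc k) v}}" (is "?C = ?P")
proof (intro equalityI subsetI)
  fix v assume "v \<in> ?C"
  then have "([], v) \<in> {(u, w). {u, w} \<in> tree_edges (tree_of \<xi>) \<and> \<omega> {u, w}}\<^sup>*"
    by (simp add: cluster_def)
  then show "v \<in> ?P"
  proof (induction rule: rtrancl_induct)
    case base
    then show ?case by (simp add: Nil_in_tree_of)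
  next
    case (step v w)
    from step.hyps(2) obtain u i where u: "{v, w} = {u, u @ [i]}" "u \<in> tree_of \<xi>" "i < \<xi> u"
      and open_edge: "\<omega> {v, w}"
      by (auto simp: tree_edges_tree_of_iff)
    from u(1) consider "v = u" "w = u @ [i]" | "v = u @ [i]" "w = u"
      by (auto simp: doubleton_eq_iff)
    then show ?case
    proof cases
      case 1
      with u step.IH open_edge show ?thesis by (auto simp: snoc_in_tree_of_iff less_Suc_eq)
    next
      case 2
      have "\<omega> {take k u, take (Suc k) u}" if "k < length u" for k
        using step.IH that 2 by (auto dest: spec[of _ k])
      with u 2 show ?thesis by simp
    qed
  qed
next
  fix v assume "v \<in> ?P"
  then show "v \<in> ?C"
  proof (induction v rule: rev_induct)
    case Nil
    then show ?case by (simp add: cluster_def)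
  next
    case (snoc i v)
    have "\<omega> {take k v, take (Suc k) v}" if "k < length v" for k
      using snoc.prems that by (auto dest: spec[of _ k])
    with snoc have "v \<in> ?C" by (simp add: snoc_in_tree_of_iff)
    moreover have "{v, v @ [i]} \<in> tree_edges (tree_of \<xi>)"
      using snoc.prems by (auto simp: tree_edges_tree_of_iff snoc_in_tree_of_iff)
    moreover have "\<omega> {v, v @ [i]}"
      using snoc.prems by (auto dest: spec[of _ "length v"])
    ultimately show ?case
      by (auto simp: cluster_def intro: rtrancl_into_rtrancl)
  qed
qed

text \<open>Levels are finite, so an infinite cluster has vertices at depth at least
  \<open>n\<close>, whose ancestral paths are cut at length \<open>n\<close>. Conversely, a cluster
  with vertices at every depth is infinite.\<close>

lemma infinite_cluster_iff_reaches:
  "infinite (cluster (tree_edges (tree_of \<xi>)) \<omega> []) \<longleftrightarrow> (\<forall>n. reaches \<xi> n [] \<omega>)"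
  (is "infinite ?C \<longleftrightarrow> _")
proof (intro iffI allI)
  fix n assume inf: "infinite ?C"
  have "finite (\<Union>m<n. {v \<in> tree_of \<xi>. length v = m})" by (intro finite_UN_I finite_level_tree_of) auto
  then have "\<not> ?C \<subseteq> (\<Union>m<n. {v \<in> tree_of \<xi>. length v = m})" using inf finite_subset by blast
  then obtain v where v: "v \<in> ?C" "n \<le> length v" by (fastforce simp: cluster_tree_of)
  have "take n v \<in> tree_of \<xi>"
    using v append_in_tree_ofD[of "take n v" "drop n v"] by (simp add: cluster_tree_of)
  with v show "reaches \<xi> n [] \<omega>"
    by (auto simp: reaches_iff_path Nil_in_tree_of cluster_tree_of min_def intro!: exI[of _ "take n v"])
next
  assume reach: "\<forall>n. reaches \<xi> n [] \<omega>"
  have "n \<in> length ` ?C" for n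
    using spec[OF reach, of n] by (auto simp: reaches_iff_path Nil_in_tree_of cluster_tree_of)
  then have "length ` ?C = UNIV" by blast
  then show "infinite ?C" by (metis finite_imageI infinite_UNIV_nat)
qed

text \<open>\<open>K\<close> has to contain only the edges below \<open>v\<close>, so that
  measurability is available over the block of a single child, as the independence argument
  requires.\<close>

lemma measurable_reaches:
  assumes "v \<in> tree_of \<xi>"
    and "\<And>w i. prefix v w \<Longrightarrow> w @ [i] \<in> tree_of \<xi> \<Longrightarrow> {w, w @ [i]} \<in> K"
  shows "Measurable.pred (PiM K (\<lambda>_. measure_pmf (bernoulli_pmf q))) (reaches \<xi> n v)"
  using assms
proof (induction n arbitrary: v)
  case 0
  have "reaches \<xi> 0 v = (\<lambda>_. True)" by (simp add: fun_eq_iff)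
  then show ?case by simp
next
  case (Suc n)
  let ?M = "PiM K (\<lambda>_. measure_pmf (bernoulli_pmf q))"
  have "Measurable.pred ?M (\<lambda>\<omega>. \<omega> {v, v @ [i]} \<and> reaches \<xi> n (v @ [i]) \<omega>)" if "i < \<xi> v" for i
  proof -
    have child: "v @ [i] \<in> tree_of \<xi>" using Suc.prems that by (simp add: snoc_in_tree_of_iff)
    have [measurable]: "Measurable.pred ?M (reaches \<xi> n (v @ [i]))"
      by (rule Suc.IH[OF child]) (metis Suc.prems(2) append_prefixD)
    have [measurable]: "Measurable.pred ?M (\<lambda>\<omega>. \<omega> {v, v @ [i]})"
      using measurable_component_singleton[of "{v, v @ [i]}" K "\<lambda>_. measure_pmf (bernoulli_pmf q)"]
        Suc.prems(2)[OF prefix_order.refl child] by simp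
    show ?thesis by measurable
  qed
  then have "Measurable.pred ?M (\<lambda>\<omega>. \<exists>i\<in>{..<\<xi> v}. \<omega> {v, v @ [i]} \<and> reaches \<xi> n (v @ [i]) \<omega>)"
    by (intro pred_intros_finite) auto
  moreover have "reaches \<xi> (Suc n) v = (\<lambda>\<omega>. \<exists>i\<in>{..<\<xi> v}. \<omega> {v, v @ [i]} \<and> reaches \<xi> n (v @ [i]) \<omega>)"
    by (simp add: fun_eq_iff Bex_def)
  ultimately show ?case by (simp only:)
qed

lemma reaches_restrict:
  assumes "v \<in> tree_of \<xi>"
    and "\<And>w i. prefix v w \<Longrightarrow> w @ [i] \<in> tree_of \<xi> \<Longrightarrow> {w, w @ [i]} \<in> K"
  shows "reaches \<xi> n v (restrict \<omega> K) \<longleftrightarrow> reaches \<xi> n v \<omega>"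
  using assms
proof (induction n arbitrary: v)
  case (Suc n)
  have "reaches \<xi> n (v @ [i]) (restrict \<omega> K) \<longleftrightarrow> reaches \<xi> n (v @ [i]) \<omega>"
    and "restrict \<omega> K {v, v @ [i]} = \<omega> {v, v @ [i]}" if "i < \<xi> v" for i
  proof -
    have child: "v @ [i] \<in> tree_of \<xi>" using Suc.prems that by (simp add: snoc_in_tree_of_iff)
    show "restrict \<omega> K {v, v @ [i]} = \<omega> {v, v @ [i]}"
      by (rule restrict_apply') (rule Suc.prems(2)[OF prefix_order.refl child])
    show "reaches \<xi> n (v @ [i]) (restrict \<omega> K) \<longleftrightarrow> reaches \<xi> n (v @ [i]) \<omega>"
      by (rule Suc.IH[OF child]) (metis Suc.prems(2) append_prefixD)
  qed
  then show ?case unfolding reaches.simps by blast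
qed simp

text \<open>Both endpoints of an edge are prefixes of the lower one, and a list has one prefix of
  each length. Hence the edge blocks of distinct siblings are disjoint.\<close>

lemma prefix_edge_unique:
  assumes e: "e = {u, u @ [k]}" and x: "x \<in> e" "prefix w x" and y: "y \<in> e" "prefix w' y"
    and len: "length w = length w'"
  shows "w = w'"
proof -
  have "prefix w (u @ [k])" "prefix w' (u @ [k])"
    using e x y by (auto intro: prefix_order.trans)
  then show ?thesis using len by (metis append_eq_append_conv prefix_def)
qed

text \<open>Failure to descend \<open>n + 1\<close> levels means failure through every child. These
  events use disjoint edge sets, and each occurs if the edge to the child is vacant, or if it is
  occupied and the child fails to descend \<open>n\<close> levels.\<close>

lemma emeasure_not_reaches:
  assumes q: "0 \<le> q" "q \<le> 1" and v: "v \<in> tree_of \<xi>"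
  defines "M \<equiv> bond_percolation q (tree_edges (tree_of \<xi>))"
  shows "emeasure M {\<omega> \<in> space M. \<not> reaches \<xi> n v \<omega>} = ennreal (extinction (1 - q) q \<xi> n v)"
  using v
proof (induction n arbitrary: v)
  case (Suc n)
  let ?E = "tree_edges (tree_of \<xi>)" and ?B = "\<lambda>_::nat list set. measure_pmf (bernoulli_pmf q)"
  have M: "M = PiM ?E ?B" by (simp add: M_def bond_percolation_def)
  have edge: "{w, w @ [i]} \<in> ?E" if "w @ [i] \<in> tree_of \<xi>" for w i
    using that by (auto simp: tree_edges_tree_of_iff snoc_in_tree_of_iff)
  have child: "v @ [i] \<in> tree_of \<xi>" if "i < \<xi> v" for i
    using that Suc.prems by (simp add: snoc_in_tree_of_iff)
  define h :: "nat \<Rightarrow> (nat list set \<Rightarrow> bool) \<Rightarrow> ennreal" where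
    "h i \<omega> = of_bool (\<not> (\<omega> {v, v @ [i]} \<and> reaches \<xi> n (v @ [i]) \<omega>))" for i \<omega>
  have reaches_M [measurable]: "Measurable.pred M (reaches \<xi> m w)" if "w \<in> tree_of \<xi>" for m w
    unfolding M using that edge by (intro measurable_reaches) auto
  have Eh: "(\<integral>\<^sup>+\<omega>. h i \<omega> \<partial>M) = ennreal (1 - q + q * extinction (1 - q) q \<xi> n (v @ [i]))"
    if i: "i < \<xi> v" for i
  proof -
    \<comment> \<open>Requiring both endpoints below the child keeps the connecting edge
      \<open>?e\<close> out of \<open>?L\<close>.\<close>
    let ?e = "{v, v @ [i]}" and ?L = "{e \<in> ?E. \<forall>x\<in>e. prefix (v @ [i]) x}"
    have e: "?e \<in> ?E" using edge child[OF i] .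
    have L: "{w, w @ [j]} \<in> ?L" if "prefix (v @ [i]) w" "w @ [j] \<in> tree_of \<xi>" for w j
      using that edge by (auto intro: prefix_order.trans)
    have coord [measurable]: "Measurable.pred (PiM K ?B) (\<lambda>\<omega>. \<omega> ?e)" if "?e \<in> K" for K
      using measurable_component_singleton[of ?e K ?B] that by simp
    have [measurable]: "Measurable.pred M (\<lambda>\<omega>. \<omega> ?e)" unfolding M using coord[OF e] .
    \<comment> \<open>A Boolean index turns the independence of two factors into an instance of the
      product lemma: \<open>True\<close> stands for the edge, \<open>False\<close> for the
      subtree.\<close>
    define f :: "bool \<Rightarrow> (nat list set \<Rightarrow> bool) \<Rightarrow> ennreal" where
      "f b \<omega> = of_bool (if b then \<omega> ?e else \<not> reaches \<xi> n (v @ [i]) \<omega>)" for b \<omega>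
    have [measurable]: "f b \<in> borel_measurable M" for b
      unfolding f_def[abs_def] using reaches_M[OF child[OF i]] by (cases b) simp_all
    have "(\<integral>\<^sup>+\<omega>. (\<Prod>b\<in>UNIV. f b \<omega>) \<partial>M) = (\<Prod>b\<in>UNIV. \<integral>\<^sup>+\<omega>. f b \<omega> \<partial>M)"
      unfolding M
    proof (rule nn_integral_prod_PiM_disjoint[where K = "\<lambda>b. if b then {?e} else ?L"])
      show "disjoint_family_on (\<lambda>b. if b then {?e} else ?L) UNIV"
        by (auto simp: disjoint_family_on_def)
      show "f b \<in> borel_measurable (PiM (if b then {?e} else ?L) ?B)" for b
      proof (cases b)
        case True
        then show ?thesis using coord[of "{?e}"] by (simp add: f_def[abs_def])
      next
        case False
        then show ?thesis
          using measurable_reaches[OF child[OF i] L, of n q] by (simp add: f_def[abs_def])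
      qed
      show "f b (restrict \<omega> (if b then {?e} else ?L)) = f b \<omega>" for b \<omega>
        using reaches_restrict[OF child[OF i] L, of n \<omega>] by (simp add: f_def)
    qed (use e in \<open>auto intro: prob_space_measure_pmf\<close>)
    also have "\<dots> = (\<integral>\<^sup>+\<omega>. f True \<omega> \<partial>M) * (\<integral>\<^sup>+\<omega>. f False \<omega> \<partial>M)"
      by (simp add: UNIV_bool mult.commute)
    also have "(\<integral>\<^sup>+\<omega>. f False \<omega> \<partial>M) = ennreal (extinction (1 - q) q \<xi> n (v @ [i]))"
      using Suc.IH[OF child[OF i]] reaches_M[OF child[OF i]]
      by (simp add: f_def nn_integral_indicator[symmetric] indicator_def of_bool_def cong: nn_integral_cong_simp)
    also have "(\<integral>\<^sup>+\<omega>. f True \<omega> \<partial>M) = (\<integral>\<^sup>+\<omega>. of_bool (\<omega> ?e) \<partial>M)"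
      by (simp add: f_def)
    also have "\<dots> = ennreal q"
      unfolding M
      using q by (subst nn_integral_PiM_coordinate[OF _ e, where f = of_bool])
        (auto intro: prob_space_measure_pmf)
    finally have both: "(\<integral>\<^sup>+\<omega>. f True \<omega> * f False \<omega> \<partial>M) = ennreal (q * extinction (1 - q) q \<xi> n (v @ [i]))"
      using q by (simp add: UNIV_bool mult.commute ennreal_mult extinction_nonneg)
    have "(\<integral>\<^sup>+\<omega>. of_bool (\<not> \<omega> ?e) \<partial>M) = ennreal (1 - q)"
      unfolding M
      using q by (subst nn_integral_PiM_coordinate[OF _ e, where f = "\<lambda>b. of_bool (\<not> b)"])
        (auto intro: prob_space_measure_pmf)
    \<comment> \<open>Failure through child \<open>i\<close> splits into disjoint cases according to
      the state of the connecting edge.\<close>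
    moreover have "h i \<omega> = of_bool (\<not> \<omega> ?e) + f True \<omega> * f False \<omega>" for \<omega>
      by (auto simp: h_def f_def)
    then have "(\<integral>\<^sup>+\<omega>. h i \<omega> \<partial>M) = (\<integral>\<^sup>+\<omega>. of_bool (\<not> \<omega> ?e) \<partial>M) + (\<integral>\<^sup>+\<omega>. f True \<omega> * f False \<omega> \<partial>M)"
      by (simp only:) (rule nn_integral_add, measurable)
    ultimately show ?thesis
      using q both by (simp add: extinction_nonneg)
  qed
  have prod_h: "(\<integral>\<^sup>+\<omega>. (\<Prod>i<\<xi> v. h i \<omega>) \<partial>M) = (\<Prod>i<\<xi> v. \<integral>\<^sup>+\<omega>. h i \<omega> \<partial>M)"
  proof (cases "\<xi> v = 0")
    \<comment> \<open>Without children the product is empty; the edge set may then be empty too,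
      which the independence lemma excludes.\<close>
    case True
    interpret prob_space M unfolding M by (intro prob_space_PiM prob_space_measure_pmf)
    show ?thesis by (simp add: True emeasure_space_1)
  next
    case False
    \<comment> \<open>One endpoint below the child suffices here, so the block of child
      \<open>i\<close> includes its connecting edge.\<close>
    let ?K = "\<lambda>i. {e \<in> ?E. \<exists>x\<in>e. prefix (v @ [i]) x}"
    have K: "{w, w @ [j]} \<in> ?K i" if "prefix (v @ [i]) w" "w @ [j] \<in> tree_of \<xi>" for i j w
      using that edge by auto
    have e: "{v, v @ [i]} \<in> ?K i" if "i < \<xi> v" for i
      using edge child[OF that] by auto
    show ?thesis
      unfolding M
    proof (rule nn_integral_prod_PiM_disjoint[where K = ?K])
      show "?E \<noteq> {}" using False e[of 0] by auto
      show "disjoint_family_on ?K {..<\<xi> v}"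
      proof (unfold disjoint_family_on_def, intro ballI impI)
        fix i j :: nat assume "i \<noteq> j"
        have "i = j" if "e \<in> ?K i" "e \<in> ?K j" for e
        proof -
          from that obtain u k x y where "e = {u, u @ [k]}" "x \<in> e" "prefix (v @ [i]) x" "y \<in> e" "prefix (v @ [j]) y"
            by (auto simp: tree_edges_def)
          from prefix_edge_unique[OF this] show "i = j" by simp
        qed
        with \<open>i \<noteq> j\<close> show "?K i \<inter> ?K j = {}" by blast
      qed
      fix i assume "i \<in> {..<\<xi> v}"
      then have i: "i < \<xi> v" by simp
      have "Measurable.pred (PiM (?K i) ?B) (\<lambda>\<omega>. \<omega> {v, v @ [i]})"
        using measurable_component_singleton[OF e[OF i], of ?B] by simp
      moreover have "Measurable.pred (PiM (?K i) ?B) (reaches \<xi> n (v @ [i]))"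
        using K by (intro measurable_reaches child i) auto
      ultimately show "h i \<in> borel_measurable (PiM (?K i) ?B)"
        unfolding h_def[abs_def] by simp
      show "h i (restrict \<omega> (?K i)) = h i \<omega>" for \<omega>
        using reaches_restrict[OF child[OF i] K[of i], of n \<omega>] e[OF i] by (simp add: h_def)
    qed (auto intro: prob_space_measure_pmf)
  qed
  have "emeasure M {\<omega> \<in> space M. \<not> reaches \<xi> (Suc n) v \<omega>} = (\<integral>\<^sup>+\<omega>. indicator {\<omega> \<in> space M. \<not> reaches \<xi> (Suc n) v \<omega>} \<omega> \<partial>M)"
    using Suc.prems reaches_M[OF Suc.prems, of "Suc n"] by (intro nn_integral_indicator[symmetric]) measurable
  also have "\<dots> = (\<integral>\<^sup>+\<omega>. (\<Prod>i<\<xi> v. h i \<omega>) \<partial>M)"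
    by (intro nn_integral_cong) (auto simp: h_def indicator_def)
  also have "\<dots> = (\<Prod>i<\<xi> v. ennreal (1 - q + q * extinction (1 - q) q \<xi> n (v @ [i])))"
    unfolding prod_h by (intro prod.cong) (auto simp: Eh)
  also have "\<dots> = ennreal (extinction (1 - q) q \<xi> (Suc n) v)"
    unfolding extinction.simps using q by (intro prod_ennreal) (auto simp: extinction_nonneg)
  finally show ?case .
qed simp

text \<open>The events of reaching level \<open>n\<close> decrease to the event of an infinite
  cluster, so continuity from above applies.\<close>

lemma extinction_tendsto_percolation_density:
  assumes q: "0 \<le> q" "q \<le> 1"
  shows "(\<lambda>n. extinction (1 - q) q \<xi> n []) \<longlonglongrightarrow> 1 - percolation_density (tree_of \<xi>) q"
proof -
  let ?M = "bond_percolation q (tree_edges (tree_of \<xi>))"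
  interpret prob_space ?M
    unfolding bond_percolation_def by (intro prob_space_PiM prob_space_measure_pmf)
  let ?A = "\<lambda>n. {\<omega> \<in> space ?M. reaches \<xi> n [] \<omega>}"
  have [measurable]: "Measurable.pred ?M (reaches \<xi> n [])" for n
    unfolding bond_percolation_def
    by (intro measurable_reaches) (auto simp: Nil_in_tree_of tree_edges_tree_of_iff snoc_in_tree_of_iff)
  have "prob (?A n) = 1 - extinction (1 - q) q \<xi> n []" for n
  proof -
    have "prob {\<omega> \<in> space ?M. \<not> reaches \<xi> n [] \<omega>} = extinction (1 - q) q \<xi> n []"
      using emeasure_not_reaches[OF q Nil_in_tree_of, of \<xi> n] q
      by (simp add: measure_def extinction_nonneg)
    moreover have "prob {\<omega> \<in> space ?M. \<not> reaches \<xi> n [] \<omega>} = 1 - prob (?A n)"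
      by (rule prob_neg) measurable
    ultimately show ?thesis by simp
  qed
  moreover have "(\<lambda>n. prob (?A n)) \<longlonglongrightarrow> prob (\<Inter>n. ?A n)"
    using reaches_Suc_imp by (intro finite_Lim_measure_decseq decseq_SucI) (auto simp del: reaches.simps)
  moreover have "(\<Inter>n. ?A n) = {\<omega> \<in> space ?M. infinite (cluster (tree_edges (tree_of \<xi>)) \<omega> [])}"
    by (auto simp: infinite_cluster_iff_reaches)
  ultimately have "(\<lambda>n. 1 - extinction (1 - q) q \<xi> n []) \<longlonglongrightarrow> percolation_density (tree_of \<xi>) q"
    by (simp add: percolation_density_def)
  from tendsto_diff[OF tendsto_const[of 1] this] show ?thesis by simp
qed

section \<open>The averaged recursion\<close>

text \<open>For \<open>a = 1 - x\<close> and \<open>b = x\<close> the map \<open>s \<mapsto> G (a + b s)\<close>, with \<open>G\<close> the generating function of \<open>p\<close>, fixes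
  \<open>1\<close> with slope \<open>x \<mu> > 1\<close>, so it lies strictly below the diagonal just left of \<open>1\<close>; this survives a
  small increase of \<open>a\<close> and \<open>b\<close>. Truncating \<open>G\<close> to a polynomial that dominates it on \<open>[0, 1]\<close> covers the
  case \<open>\<mu> = \<infinity>\<close> as well.\<close>

lemma supercritical_contraction:
  fixes p :: "nat pmf" and \<mu> :: ennreal
  assumes \<mu>: "\<mu> = (\<integral>\<^sup>+ n. of_nat n \<partial>measure_pmf p)" "\<mu> > 1"
    and x: "enn2real (1 / \<mu>) < x" "x \<le> 1"
  obtains \<delta> where "\<delta> > 0"
    "\<And>a b. 1 - x \<le> a \<Longrightarrow> a < 1 - x + \<delta> \<Longrightarrow> x \<le> b \<Longrightarrow> b < x + \<delta> \<Longrightarrow>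
      \<exists>s\<ge>0. (\<integral>\<^sup>+ k. ennreal ((a + b * s) ^ k) \<partial>measure_pmf p) \<le> ennreal s"
proof -
  have "x > 0" using x(1) enn2real_nonneg[of "1 / \<mu>"] by linarith
  \<comment> \<open>For infinite \<open>\<mu>\<close> the quotient \<open>1 / \<mu>\<close> is zero,
    and \<open>x > 0\<close> makes the product infinite.\<close>
  have "1 < ennreal x * \<mu>"
  proof (cases \<mu>)
    case (real m)
    then have "m > 1" using \<mu>(2) by (simp add: ennreal_less_iff flip: ennreal_1)
    then have "enn2real (1 / \<mu>) = 1 / m"
      using real by (simp add: divide_ennreal flip: ennreal_1)
    with x(1) have "1 / m < x" by simp
    then have "1 < x * m" using \<open>m > 1\<close> by (simp add: field_simps)
    then show ?thesis using real \<open>x > 0\<close> by (simp add: ennreal_less_iff flip: ennreal_1 ennreal_mult)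
  next
    case top
    then show ?thesis using \<open>x > 0\<close> by (simp add: ennreal_mult_top)
  qed
  also have "ennreal x * \<mu> = (\<Sum>k. ennreal (x * (pmf p k * real k)))"
    using \<open>x > 0\<close>
    by (simp add: \<mu> nn_integral_measure_pmf nn_integral_count_space_nat ennreal_mult flip: ennreal_of_nat_eq_real_of_nat)
  also have "\<dots> = (SUP N. \<Sum>k<N. ennreal (x * (pmf p k * real k)))"
    by (rule suminf_eq_SUP)
  \<comment> \<open>Finitely many terms already push the slope at \<open>1\<close> above
    \<open>1\<close>.\<close>
  finally obtain N where "1 < (\<Sum>k<N. ennreal (x * (pmf p k * real k)))"
    by (auto simp: less_SUP_iff)
  then have N: "1 < (\<Sum>k<N. x * (pmf p k * real k))"
    using \<open>x > 0\<close> by (simp add: ennreal_less_iff sum_ennreal flip: ennreal_1)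

  \<comment> \<open>\<open>H\<close> is the generating function with \<open>t ^ k\<close> replaced
    by \<open>1\<close> for \<open>k \<ge> N\<close>: a polynomial with \<open>H 1 = 1\<close> that
    dominates it on \<open>[0, 1]\<close>.\<close>
  define H where "H t = 1 - (\<Sum>k<N. pmf p k * (1 - t ^ k))" for t :: real
  have G_le_H: "(\<integral>\<^sup>+ k. ennreal (t ^ k) \<partial>measure_pmf p) \<le> ennreal (H t)"
    if t: "0 \<le> t" "t \<le> 1" for t
  proof -
    have int: "integrable (measure_pmf p) (\<lambda>k. t ^ k)"
      using t by (intro measure_pmf.integrable_const_bound[where B = 1]) (auto simp: power_le_one)
    have ind: "integrable (measure_pmf p) (\<lambda>k. indicator {j} k * (1 - t ^ j))" for j
      by (intro integrable_mult_left) (auto simp: integrable_indicator_iff measure_pmf.emeasure_eq_measure)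
    then have sum: "integrable (measure_pmf p) (\<lambda>k. \<Sum>j<N. indicator {j} k * (1 - t ^ j))"
      by (rule Bochner_Integration.integrable_sum)
    then have int': "integrable (measure_pmf p) (\<lambda>k. 1 - (\<Sum>j<N. indicator {j} k * (1 - t ^ j)))"
      by (intro Bochner_Integration.integrable_diff) auto
    have "(\<integral>\<^sup>+ k. ennreal (t ^ k) \<partial>measure_pmf p) = ennreal (measure_pmf.expectation p (\<lambda>k. t ^ k))"
      using t by (intro nn_integral_eq_integral int) auto
    also have "measure_pmf.expectation p (\<lambda>k. t ^ k) \<le>
        measure_pmf.expectation p (\<lambda>k. 1 - (\<Sum>j<N. indicator {j} k * (1 - t ^ j)))"
    proof (rule integral_mono[OF int int'])
      fix k
      have "(\<Sum>j<N. indicator {j} k * (1 - t ^ j)) = (if k < N then 1 - t ^ k else 0)"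
        by (simp add: indicator_def if_distrib[of "\<lambda>c. c * _"] sum.delta cong: if_cong)
      then show "t ^ k \<le> 1 - (\<Sum>j<N. indicator {j} k * (1 - t ^ j))"
        using t by (simp add: power_le_one)
    qed
    also have "\<dots> = H t"
      using Bochner_Integration.integral_diff[OF _ sum, of "\<lambda>_. 1"]
        Bochner_Integration.integral_sum[OF ind, where I = "{..<N}"]
      by (simp only: H_def) (simp add: measure_pmf_single)
    finally show ?thesis by (simp add: ennreal_leI)
  qed

  \<comment> \<open>This function vanishes at \<open>1\<close> with negative derivative, so it is
    positive just left of \<open>1\<close>.\<close>
  have "((\<lambda>s. s - H (1 - x + x * s)) has_real_derivative
      1 - (\<Sum>k<N. pmf p k * (real k * x))) (at 1)"
    unfolding H_def by (auto intro!: derivative_eq_intros simp: sum_negf mult_ac)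
  moreover have "1 - (\<Sum>k<N. pmf p k * (real k * x)) < 0"
    using N by (simp add: mult_ac)
  ultimately obtain d where d: "d > 0"
    "\<And>h. 0 < h \<Longrightarrow> h < d \<Longrightarrow> 1 - H (1 - x + x * 1) < (1 - h) - H (1 - x + x * (1 - h))"
    using DERIV_neg_dec_left by blast
  \<comment> \<open>The halves keep \<open>1 - s\<close> strictly below \<open>d\<close> and
    \<open>s\<close> strictly positive.\<close>
  define s where "s = 1 - min (d / 2) (1 / 2)"
  have s: "0 < s" "s < 1" "H (1 - x + x * s) < s"
    using d(2)[of "min (d / 2) (1 / 2)"] \<open>d > 0\<close> by (auto simp: s_def H_def)
  define t where "t = 1 - x + x * s"
  have "0 < x * s" "x * s < x" using s \<open>x > 0\<close> by auto
  then have t: "0 \<le> t" "t < 1" using x by (auto simp: t_def)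
  have "isCont H t" unfolding H_def by (intro continuous_intros)
  then have "(H \<longlongrightarrow> H t) (nhds t)" by (simp add: isCont_def tendsto_at_iff_tendsto_nhds)
  then have "\<forall>\<^sub>F u in nhds t. H u < s \<and> u < 1"
    using s t by (intro eventually_conj order_tendstoD(2)[where y = "H t"] order_tendstoD(2)[OF filterlim_ident]) (auto simp: t_def)
  then obtain e where e: "e > 0" "\<And>u. dist u t < e \<Longrightarrow> H u < s \<and> u < 1"
    by (auto simp: eventually_nhds_metric)
  show thesis
  \<comment> \<open>Half of the margin \<open>e\<close> around \<open>t\<close> goes to
    \<open>a\<close> and half to \<open>b * s\<close>, where \<open>s < 1\<close>.\<close>
  proof (rule that[of "e / 2"])
    fix a b assume ab: "1 - x \<le> a" "a < 1 - x + e / 2" "x \<le> b" "b < x + e / 2"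
    have "x * s \<le> b * s" using ab s by (intro mult_right_mono) auto
    moreover have "b * s \<le> x * s + e / 2"
    proof -
      have "b * s \<le> (x + e / 2) * s" using ab s by (intro mult_right_mono) auto
      moreover have "e / 2 * s \<le> e / 2 * 1" using s e(1) by (intro mult_left_mono) auto
      ultimately show ?thesis by (simp add: algebra_simps)
    qed
    ultimately have "t \<le> a + b * s" "a + b * s < t + e" using ab by (auto simp: t_def)
    then have "H (a + b * s) < s" "a + b * s < 1" "0 \<le> a + b * s"
      using e(2)[of "a + b * s"] t by (auto simp: dist_real_def)
    with G_le_H[of "a + b * s"] s show
      "\<exists>s\<ge>0. (\<integral>\<^sup>+ k. ennreal ((a + b * s) ^ k) \<partial>measure_pmf p) \<le> ennreal s"
      by (intro exI[of _ s]) (auto intro: order_trans ennreal_leI)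
  qed (use e in simp)
qed

section \<open>Moment bounds for the dominating sequence\<close>

lemma measurable_extinction:
  fixes a b :: real
  assumes "\<And>w. v @ w \<in> K"
  shows "(\<lambda>\<xi>. extinction a b \<xi> n v) \<in> borel_measurable (PiM K (\<lambda>_. measure_pmf p))"
  using assms
proof (induction n arbitrary: v)
  case (Suc n)
  have "(\<lambda>\<xi>. extinction a b \<xi> n (v @ [i])) \<in> borel_measurable (PiM K (\<lambda>_. measure_pmf p))" for i
    by (rule Suc.IH) (use Suc.prems in simp)
  note [measurable] = this
  \<comment> \<open>The number of factors is random, so measurability is checked for each fixed
    number \<open>k\<close> and glued over the countably many values of
    \<open>\<xi> v\<close>.\<close>
  have "(\<lambda>\<xi>. \<xi> v) \<in> measurable (PiM K (\<lambda>_. measure_pmf p)) (count_space UNIV)"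
    using measurable_component_singleton[of v K "\<lambda>_. measure_pmf p"] Suc.prems[of "[]"] by simp
  moreover have "(\<lambda>\<xi>. \<Prod>i<k. a + b * extinction a b \<xi> n (v @ [i])) \<in> borel_measurable (PiM K (\<lambda>_. measure_pmf p))"
    for k by measurable
  ultimately show ?case
    unfolding extinction.simps
    by (rule measurable_compose_countable[where g = "\<lambda>\<xi>. \<xi> v", rotated])
qed simp

text \<open>Given \<open>\<xi> v = k\<close>, the factors of the children are independent with means
  at most \<open>a + b * s\<close> by induction, and averaging the \<open>k\<close>-th power over
  \<open>k\<close> gives at most \<open>s\<close>. Keeping \<open>v\<close> arbitrary replaces an
  appeal to identically distributed subtrees.\<close>

lemma nn_integral_extinction_le:
  fixes a b s :: real and p :: "nat pmf"
  assumes ab: "0 \<le> a" "0 \<le> b" and s: "0 \<le> s"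
    and G: "(\<integral>\<^sup>+ k. ennreal ((a + b * s) ^ k) \<partial>measure_pmf p) \<le> ennreal s"
  shows "(\<integral>\<^sup>+ \<xi>. ennreal (extinction a b \<xi> n v) \<partial>PiM UNIV (\<lambda>_. measure_pmf p)) \<le> ennreal s"
proof (induction n arbitrary: v)
  case (Suc n)
  let ?M = "PiM UNIV (\<lambda>_::nat list. measure_pmf p)"
  interpret M: prob_space ?M by (intro prob_space_PiM prob_space_measure_pmf)
  define Y where "Y i \<xi> = ennreal (a + b * extinction a b \<xi> n (v @ [i]))" for i \<xi>
  have Y_measurable: "Y i \<in> borel_measurable (PiM K (\<lambda>_. measure_pmf p))"
    if "range (\<lambda>w. v @ i # w) \<subseteq> K" for i K
  proof -
    have [measurable]: "(\<lambda>\<xi>. extinction a b \<xi> n (v @ [i])) \<in> borel_measurable (PiM K (\<lambda>_. measure_pmf p))"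
      by (rule measurable_extinction) (use that in auto)
    show ?thesis unfolding Y_def by measurable
  qed
  have [measurable]: "Y i \<in> borel_measurable ?M" for i by (rule Y_measurable) simp
  have [measurable]: "(\<lambda>\<xi>. \<xi> v) \<in> measurable ?M (count_space UNIV)"
    using measurable_component_singleton[of v UNIV "\<lambda>_. measure_pmf p"] by simp
  have indicator_k: "(\<lambda>\<xi>. indicator {k} (\<xi> v) :: ennreal) \<in> borel_measurable ?M" for k
    by (rule measurable_compose[of "\<lambda>\<xi>. \<xi> v" _ "count_space UNIV"]) auto
  have EY: "(\<integral>\<^sup>+ \<xi>. Y i \<xi> \<partial>?M) \<le> ennreal (a + b * s)" for i
  proof -
    have [measurable]: "(\<lambda>\<xi>. extinction a b \<xi> n (v @ [i])) \<in> borel_measurable ?M"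
      by (rule measurable_extinction) simp
    have "(\<integral>\<^sup>+ \<xi>. Y i \<xi> \<partial>?M) =
        ennreal a + ennreal b * (\<integral>\<^sup>+ \<xi>. ennreal (extinction a b \<xi> n (v @ [i])) \<partial>?M)"
      using ab extinction_nonneg[OF ab]
      by (simp add: Y_def ennreal_mult nn_integral_add nn_integral_cmult M.emeasure_space_1)
    also have "\<dots> \<le> ennreal a + ennreal b * ennreal s"
      by (intro add_left_mono mult_left_mono Suc.IH) auto
    also have "\<dots> = ennreal (a + b * s)" using ab s by (simp add: ennreal_mult)
    finally show ?thesis .
  qed
  have factor: "(\<integral>\<^sup>+ \<xi>. (\<Prod>i<k. Y i \<xi>) * indicator {k} (\<xi> v) \<partial>?M)
      = (\<Prod>i<k. \<integral>\<^sup>+ \<xi>. Y i \<xi> \<partial>?M) * ennreal (pmf p k)" for k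
  proof -
    \<comment> \<open>Index \<open>0\<close> carries the event \<open>\<xi> v = k\<close> and index
      \<open>Suc i\<close> the factor of child \<open>i\<close>; the blocks are \<open>v\<close>
      itself and the subtrees of its children.\<close>
    define f where "f j \<xi> = (case j of 0 \<Rightarrow> indicator {k} (\<xi> v) | Suc i \<Rightarrow> Y i \<xi>)" for j \<xi>
    define K where "K j = (case j of 0 \<Rightarrow> {v} | Suc i \<Rightarrow> range (\<lambda>w. v @ i # w))" for j
    have "(\<integral>\<^sup>+ \<xi>. (\<Prod>j<Suc k. f j \<xi>) \<partial>?M) = (\<Prod>j<Suc k. \<integral>\<^sup>+ \<xi>. f j \<xi> \<partial>?M)"
    proof (rule nn_integral_prod_PiM_disjoint[where K = K])
      show "disjoint_family_on K {..<Suc k}"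
        by (auto simp: disjoint_family_on_def K_def split: nat.splits)
      show "f j \<in> borel_measurable (PiM (K j) (\<lambda>_. measure_pmf p))" for j
      proof (cases j)
        case 0
        have "(\<lambda>\<xi>. \<xi> v) \<in> measurable (PiM {v} (\<lambda>_. measure_pmf p)) (count_space UNIV)"
          using measurable_component_singleton[of v "{v}" "\<lambda>_. measure_pmf p"] by simp
        then have "(\<lambda>\<xi>. indicator {k} (\<xi> v) :: ennreal) \<in> borel_measurable (PiM {v} (\<lambda>_. measure_pmf p))"
          by (rule measurable_compose) auto
        then show ?thesis unfolding 0 f_def[abs_def] K_def nat.case .
      next
        case (Suc i)
        then show ?thesis using Y_measurable[of i] by (simp add: f_def[abs_def] K_def)
      qed
      have "extinction a b (restrict \<xi> (range (\<lambda>w. v @ i # w))) n (v @ [i]) = extinction a b \<xi> n (v @ [i])"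
        for i \<xi>
        by (rule extinction_cong) simp
      then show "f j (restrict \<xi> (K j)) = f j \<xi>" for j \<xi>
        by (simp add: f_def K_def Y_def split: nat.splits)
    qed (auto intro: prob_space_measure_pmf)
    moreover have "(\<integral>\<^sup>+ \<xi>. indicator {k} (\<xi> v) \<partial>?M) = ennreal (pmf p k)"
      by (subst nn_integral_PiM_coordinate[where f = "indicator {k}"])
        (auto intro: prob_space_measure_pmf simp: emeasure_pmf_single)
    ultimately show ?thesis
      by (simp add: prod.lessThan_Suc_shift f_def mult.commute del: prod.lessThan_Suc)
  qed
  have "ennreal (extinction a b \<xi> (Suc n) v) = (\<Sum>k. (\<Prod>i<k. Y i \<xi>) * indicator {k} (\<xi> v))" for \<xi>
  proof -
    have "ennreal (extinction a b \<xi> (Suc n) v) = (\<Prod>i<\<xi> v. Y i \<xi>)"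
      unfolding Y_def extinction.simps
      using ab by (intro prod_ennreal[symmetric]) (auto simp: extinction_nonneg)
    also have "\<dots> = (\<Sum>k. (\<Prod>i<k. Y i \<xi>) * indicator {k} (\<xi> v))"
      by (rule suminf_cmult_indicator[symmetric]) (auto simp: disjoint_family_on_def)
    finally show ?thesis .
  qed
  then have "(\<integral>\<^sup>+ \<xi>. ennreal (extinction a b \<xi> (Suc n) v) \<partial>?M)
      = (\<Sum>k. \<integral>\<^sup>+ \<xi>. (\<Prod>i<k. Y i \<xi>) * indicator {k} (\<xi> v) \<partial>?M)"
    by (simp only:) (intro nn_integral_suminf borel_measurable_times_ennreal indicator_k, measurable)
  also have "\<dots> = (\<Sum>k. (\<Prod>i<k. \<integral>\<^sup>+ \<xi>. Y i \<xi> \<partial>?M) * ennreal (pmf p k))"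
    by (simp only: factor)
  also have "\<dots> \<le> (\<Sum>k. ennreal ((a + b * s) ^ k) * ennreal (pmf p k))"
  proof (intro suminf_le mult_right_mono summableI)
    fix k
    have "(\<Prod>i<k. \<integral>\<^sup>+ \<xi>. Y i \<xi> \<partial>?M) \<le> ennreal (a + b * s) ^ k"
    proof (induction k)
      case (Suc k)
      then show ?case by (simp add: mult.commute mult_mono EY del: ennreal_plus)
    qed simp
    then show "(\<Prod>i<k. \<integral>\<^sup>+ \<xi>. Y i \<xi> \<partial>?M) \<le> ennreal ((a + b * s) ^ k)"
      using ab s by (simp add: ennreal_power del: ennreal_plus)
  qed auto
  also have "\<dots> = (\<integral>\<^sup>+ k. ennreal ((a + b * s) ^ k) \<partial>measure_pmf p)"
    by (simp add: nn_integral_measure_pmf nn_integral_count_space_nat mult.commute)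
  finally show ?case using G by (rule order_trans)
qed simp

text \<open>Monotone convergence carries the uniform bound on the means over to the supremum, and a
  finite mean forces finiteness almost surely.\<close>

lemma AE_extinction_bounded:
  fixes a b s :: real and p :: "nat pmf"
  assumes "0 \<le> a" "0 \<le> b" "0 \<le> s"
    and "(\<integral>\<^sup>+ k. ennreal ((a + b * s) ^ k) \<partial>measure_pmf p) \<le> ennreal s"
  shows "AE \<xi> in PiM UNIV (\<lambda>_. measure_pmf p). (SUP n. ennreal (extinction a b \<xi> n v)) \<noteq> \<infinity>"
proof (rule nn_integral_PInf_AE)
  let ?M = "PiM UNIV (\<lambda>_::nat list. measure_pmf p)"
  have [measurable]: "(\<lambda>\<xi>. extinction a b \<xi> n v) \<in> borel_measurable ?M" for n
    by (rule measurable_extinction) simp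
  show "(\<lambda>\<xi>. SUP n. ennreal (extinction a b \<xi> n v)) \<in> borel_measurable ?M" by measurable
  have "(\<integral>\<^sup>+ \<xi>. (SUP n. ennreal (extinction a b \<xi> n v)) \<partial>?M)
      = (SUP n. \<integral>\<^sup>+ \<xi>. ennreal (extinction a b \<xi> n v) \<partial>?M)"
    using incseq_extinction[OF assms(1,2)]
    by (intro nn_integral_monotone_convergence_SUP) (auto simp: mono_def le_fun_def intro!: ennreal_leI)
  also have "\<dots> \<le> ennreal s"
    by (intro SUP_least nn_integral_extinction_le assms)
  finally show "(\<integral>\<^sup>+ \<xi>. (SUP n. ennreal (extinction a b \<xi> n v)) \<partial>?M) \<noteq> \<infinity>"
    by (auto simp: top_unique)
qed

section \<open>Galton--Watson trees\<close>

text \<open>Almost sure statements pass through \<open>distr\<close> only for measurable properties of the tree, so the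
  numbers of children are read off the tree. A vertex with infinitely many children gets a junk value
  of \<open>LEAST\<close>; the condition \<open>tree_of (offspring T) = T\<close> excludes this.\<close>

definition offspring :: "nat list set \<Rightarrow> nat list \<Rightarrow> nat" where
  "offspring T v = (LEAST i. v @ [i] \<notin> T)"

lemma measurable_mem_tree_space [measurable]: "Measurable.pred tree_space (\<lambda>T. v \<in> T)"
proof -
  have "{T. v \<in> T} \<in> sets tree_space" unfolding tree_space_def by (simp add: sigma_sets.Basic)
  then show ?thesis by (simp add: pred_def tree_space_def)
qed

lemma measurable_offspring_component:
  "(\<lambda>T. offspring T v) \<in> measurable tree_space (count_space UNIV)"
  unfolding offspring_def by measurable

lemma measurable_offspring:
  "offspring \<in> measurable tree_space (PiM UNIV (\<lambda>_. measure_pmf p))"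
  by (rule measurable_PiM_single') (auto simp: measurable_offspring_component)

lemma measurable_tree_of_offspring:
  "Measurable.pred tree_space (\<lambda>T. tree_of (offspring T) = T)"
proof -
  have [measurable]: "Measurable.pred tree_space (\<lambda>T. v ! k < offspring T (take k v))" for v k
    by (rule measurable_compose[OF measurable_offspring_component]) simp
  have "Measurable.pred tree_space (\<lambda>T. v \<in> tree_of (offspring T))" for v
  proof -
    have "Measurable.pred tree_space (\<lambda>T. \<forall>k\<in>{..<length v}. v ! k < offspring T (take k v))"
      by (intro pred_intros_finite) measurable
    then show ?thesis by (simp add: tree_of_def Ball_def)
  qed
  then show ?thesis
    unfolding set_eq_iff by (intro pred_intros_countable pred_intros_logic measurable_mem_tree_space)
qed

lemma measurable_SUP_extinction_offspring:
  "(\<lambda>T. SUP n. ennreal (extinction a b (offspring T) n v)) \<in> borel_measurable tree_space"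
proof (rule measurable_compose[OF measurable_offspring])
  have [measurable]: "(\<lambda>\<xi>. extinction a b \<xi> n v) \<in> borel_measurable (PiM UNIV (\<lambda>_. measure_pmf p))"
    for n and p :: "nat pmf"
    by (rule measurable_extinction) simp
  show "(\<lambda>\<xi>. SUP n. ennreal (extinction a b \<xi> n v)) \<in> borel_measurable (PiM UNIV (\<lambda>_. measure_pmf p))"
    for p :: "nat pmf"
    by measurable
qed

section \<open>Recovering offspring counts and passing to the law on trees\<close>

lemma offspring_tree_of: "offspring (tree_of \<xi>) v = (if v \<in> tree_of \<xi> then \<xi> v else 0)"
  unfolding offspring_def snoc_in_tree_of_iff by (auto intro!: Least_equality)

lemma tree_of_offspring_tree_of: "tree_of (offspring (tree_of \<xi>)) = tree_of \<xi>"
proof (intro set_eqI)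
  show "v \<in> tree_of (offspring (tree_of \<xi>)) \<longleftrightarrow> v \<in> tree_of \<xi>" for v
    by (induction v rule: rev_induct) (auto simp: Nil_in_tree_of snoc_in_tree_of_iff offspring_tree_of)
qed

text \<open>Off the tree the recovered counts are zero and may differ from \<open>\<xi>\<close>, but
  the recursion started in the tree never leaves it.\<close>

lemma extinction_offspring_tree_of:
  assumes "v \<in> tree_of \<xi>"
  shows "extinction a b (offspring (tree_of \<xi>)) n v = extinction a b \<xi> n v"
  using assms
  by (induction n arbitrary: v) (simp_all add: offspring_tree_of snoc_in_tree_of_iff)

lemma AE_galton_watson_extinction_bounded:
  fixes p :: "nat pmf"
  assumes "countable C"
    and C: "\<And>a b. (a, b) \<in> C \<Longrightarrow> 0 \<le> a \<and> 0 \<le> b \<and>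
      (\<exists>s\<ge>0. (\<integral>\<^sup>+ k. ennreal ((a + b * s) ^ k) \<partial>measure_pmf p) \<le> ennreal s)"
  shows "AE T in galton_watson p. tree_of (offspring T) = T \<and>
    (\<forall>(a, b)\<in>C. bdd_above (range (\<lambda>n. extinction a b (offspring T) n [])))"
proof -
  let ?S = "\<lambda>a b \<xi>. SUP n. ennreal (extinction a b \<xi> n [])"
  have "AE T in galton_watson p. tree_of (offspring T) = T"
    unfolding galton_watson_def
    by (subst AE_distr_iff[OF measurable_tree_of predE[OF measurable_tree_of_offspring]])
      (simp add: tree_of_offspring_tree_of)
  moreover have "AE T in galton_watson p. \<forall>(a, b)\<in>C. ?S a b (offspring T) \<noteq> \<infinity>"
  proof (subst AE_ball_countable[OF \<open>countable C\<close>], clarify)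
    fix a b assume "(a, b) \<in> C"
    then obtain s where s: "0 \<le> a" "0 \<le> b" "0 \<le> s"
      "(\<integral>\<^sup>+ k. ennreal ((a + b * s) ^ k) \<partial>measure_pmf p) \<le> ennreal s"
      using C by blast
    have [measurable]: "(\<lambda>T. ?S a b (offspring T)) \<in> borel_measurable tree_space"
      by (rule measurable_SUP_extinction_offspring)
    have m: "{T \<in> space tree_space. ?S a b (offspring T) \<noteq> \<infinity>} \<in> sets tree_space" by measurable
    show "AE T in galton_watson p. ?S a b (offspring T) \<noteq> \<infinity>"
      unfolding galton_watson_def AE_distr_iff[OF measurable_tree_of m]
        extinction_offspring_tree_of[OF Nil_in_tree_of]
      by (rule AE_extinction_bounded[OF s])
  qed
  ultimately have "AE T in galton_watson p. tree_of (offspring T) = T \<and>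
      (\<forall>(a, b)\<in>C. ?S a b (offspring T) \<noteq> \<infinity>)"
    by (rule AE_conjI)
  then show ?thesis
  proof eventually_elim
    case (elim T)
    have "bdd_above (range (\<lambda>n. extinction a b (offspring T) n []))" if "(a, b) \<in> C" for a b
    proof -
      let ?S = "SUP n. ennreal (extinction a b (offspring T) n [])"
      have "?S \<noteq> \<infinity>" using elim that by blast
      then have "?S < \<infinity>" by (simp only: top.not_eq_extremum infinity_ennreal_def)
      have "extinction a b (offspring T) n [] \<le> enn2real ?S" for n
        using enn2real_mono[OF SUP_upper[of n UNIV "\<lambda>n. ennreal (extinction a b (offspring T) n [])"]]
          \<open>?S < \<infinity>\<close> C[OF that] extinction_nonneg[of a b "offspring T" n "[]"] by simp
      then show ?thesis by (auto intro!: bdd_aboveI[where M = "enn2real ?S"])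
    qed
    with elim show ?case by auto
  qed
qed

theorem theorem6p2:
  fixes p :: "nat pmf" and \<mu> :: ennreal and p_c :: real
  assumes "pmf p 0 = 0"
    and "\<mu> = (\<integral>\<^sup>+ n. of_nat n \<partial>measure_pmf p)"
    and "\<mu> > 1"
    and "p_c = enn2real (1 / \<mu>)"
  shows "AE T in galton_watson p. analytic_on_interval (percolation_density T) {p_c<..1}"
proof -
  \<comment> \<open>Rational pairs give one null set that serves every \<open>x\<close> at
    once.\<close>
  define C where "C = {(a, b) \<in> \<rat> \<times> \<rat>. 0 \<le> a \<and> 0 \<le> b \<and>
    (\<exists>s\<ge>0. (\<integral>\<^sup>+ k. ennreal ((a + b * s) ^ k) \<partial>measure_pmf p) \<le> ennreal s)}"
  have "countable C"
    by (rule countable_subset[OF _ countable_SIGMA[OF countable_rat countable_rat]]) (auto simp: C_def)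
  have "AE T in galton_watson p. tree_of (offspring T) = T \<and>
      (\<forall>(a, b)\<in>C. bdd_above (range (\<lambda>n. extinction a b (offspring T) n [])))"
    by (rule AE_galton_watson_extinction_bounded[OF \<open>countable C\<close>]) (auto simp: C_def)
  then show ?thesis
  proof eventually_elim
    case (elim T)
    have p_c: "0 \<le> p_c" using assms by simp
    show "analytic_on_interval (percolation_density T) {p_c<..1}"
      unfolding analytic_on_interval_def
    proof
      fix x assume "x \<in> {p_c<..1}"
      then have x: "p_c < x" "x \<le> 1" by auto
      obtain \<delta> where \<delta>: "\<delta> > 0"
        "\<And>a b. 1 - x \<le> a \<Longrightarrow> a < 1 - x + \<delta> \<Longrightarrow> x \<le> b \<Longrightarrow> b < x + \<delta> \<Longrightarrow>
          \<exists>s\<ge>0. (\<integral>\<^sup>+ k. ennreal ((a + b * s) ^ k) \<partial>measure_pmf p) \<le> ennreal s"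
        using supercritical_contraction[OF assms(2,3)] x assms(4) by metis
      obtain a where a: "a \<in> \<rat>" "1 - x < a" "a < 1 - x + \<delta>"
        using Rats_dense_in_real[of "1 - x" "1 - x + \<delta>"] \<delta>(1) by auto
      obtain b where b: "b \<in> \<rat>" "x < b" "b < x + \<delta>"
        using Rats_dense_in_real[of x "x + \<delta>"] \<delta>(1) by auto
      have ab: "(a, b) \<in> C" "0 \<le> a" "0 \<le> b"
        using a b \<delta>(2)[of a b] x p_c by (auto simp: C_def)
      \<comment> \<open>By the triangle inequality, moving less than \<open>r\<close> from
        \<open>x\<close> keeps \<open>norm (1 - z)\<close> below \<open>a\<close> and
        \<open>norm z\<close> below \<open>b\<close>.\<close>
      define r where "r = min (a - (1 - x)) (b - x)"
      let ?D = "ball (complex_of_real x) r"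
      have "norm (1 - z) \<le> a" "norm z \<le> b" if "z \<in> ?D" for z
      proof -
        have "norm (complex_of_real x - z) < r" using that by (simp add: dist_norm)
        moreover have "norm (1 - z) \<le> norm (complex_of_real (1 - x)) + norm (complex_of_real x - z)"
          using norm_triangle_ineq[of "complex_of_real (1 - x)" "complex_of_real x - z"] by simp
        moreover have "norm z \<le> norm (complex_of_real x) + norm (complex_of_real x - z)"
          using norm_triangle_ineq4[of "complex_of_real x" "complex_of_real x - z"] by simp
        moreover have "norm (complex_of_real x) = x" "norm (complex_of_real (1 - x)) = 1 - x"
          using x p_c by (simp_all only: norm_of_real)
        ultimately show "norm (1 - z) \<le> a" "norm z \<le> b" by (auto simp: r_def)
      qed
      then obtain g where g: "g holomorphic_on ?D"
        "\<And>z. z \<in> ?D \<Longrightarrow> (\<lambda>n. extinction (1 - z) z (offspring T) n []) \<longlonglongrightarrow> g z"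
        using holomorphic_limit_extinction[OF ab(2,3), of ?D "offspring T" "[]"] elim ab(1) by blast
      \<comment> \<open>The limit \<open>g\<close> extends the probability of a finite cluster, so
        \<open>1 - g\<close> is the extension of the density. Real points of the disc beyond
        \<open>1\<close> are not compared.\<close>
      have "1 - g (complex_of_real y) = complex_of_real (percolation_density T y)"
        if y: "y \<in> {p_c<..1}" "complex_of_real y \<in> ?D" for y
      proof -
        have "(\<lambda>n. extinction (1 - y) y (offspring T) n []) \<longlonglongrightarrow> 1 - percolation_density T y"
          using extinction_tendsto_percolation_density[of y "offspring T"] elim y(1) p_c by simp
        then have "(\<lambda>n. extinction (1 - complex_of_real y) (complex_of_real y) (offspring T) n [])
            \<longlonglongrightarrow> complex_of_real (1 - percolation_density T y)"
          using tendsto_of_real extinction_of_real[of "1 - y" y, where 'a = complex] by fastforce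
        with g(2)[OF y(2)] have "g (complex_of_real y) = complex_of_real (1 - percolation_density T y)"
          by (rule LIMSEQ_unique)
        then show ?thesis by simp
      qed
      moreover have "r > 0" using a b by (simp add: r_def)
      moreover have "(\<lambda>z. 1 - g z) holomorphic_on ?D" by (intro holomorphic_intros g)
      ultimately show "\<exists>r>0. \<exists>g. g holomorphic_on ball (complex_of_real x) r \<and>
          (\<forall>y\<in>{p_c<..1}. complex_of_real y \<in> ball (complex_of_real x) r \<longrightarrow>
            g (complex_of_real y) = complex_of_real (percolation_density T y))"
        by blast
    qed
  qed
qed

end
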